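(* Suppose $q(z)$ is a real form of degree $n$, and $P(z)^T=P(z)$ is a real $m\times m$ matrix-valued form of degree $n+1$, where $z\in\mathbb{C}^d$. Let $z^{\alpha_j}$, $j=1,\dots,N$, be all monomials of degree $n$ in the variables $z_1,\dots,z_d$, and let $\Psi(z)=(z^{\alpha_1}I_m,\dots,z^{\alpha_N}I_m)$, where $I_m$ is the $m\times m$ identity matrix. Then: (i) there exist real symmetric matrices $A_k$, $k=1,\dots,d$, such that $$q(\varsigma)P(z)=\Psi(\varsigma)(z_1A_1+\dots+z_dA_d)\Psi(z)^T,\qquad \varsigma,z\in\mathbb{C}^d;$$ (ii) the partial Wronskians $W_{z_k}[q(z),P(z)]$ are represented (with these matrices $A_k$) as $$q(z)\frac{\partial P(z)}{\partial z_k}-P(z)\frac{\partial q(z)}{\partial z_k}=\Psi(z)A_k\Psi(z)^T,\qquad k=1,\dots,d.$$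
   Context: A form of degree $n$ is a homogeneous polynomial of degree $n$ with real coefficients in $z_1,\dots,z_d$; a matrix-valued form of degree $n$ is $\sum_jB_jz^{\alpha_j}$ with constant (here real) matrices $B_j$ and monomials $z^{\alpha_j}$ of degree $n$. The partial Wronskian is $W_{z_k}[q,P]=q\,\partial P/\partial z_k-P\,\partial q/\partial z_k$. *)

theory Defs
  imports "HOL-Analysis.Analysis"
begin

definition exponents :: "nat \<Rightarrow> ('d::finite \<Rightarrow> nat) set" where
  "exponents n = {a. (\<Sum>k\<in>UNIV. a k) = n}"

lemma finite_exponents: "finite (exponents n :: ('d::finite \<Rightarrow> nat) set)"
proof (rule finite_subset)
  show "exponents n \<subseteq> (Pi\<^sub>E UNIV (\<lambda>_::'d. {..n}))"
    by (auto simp: exponents_def PiE_UNIV_domain intro: member_le_sum)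
  show "finite (Pi\<^sub>E UNIV (\<lambda>_::'d. {..n}))"
    by (intro finite_PiE) auto
qed

definition monomial :: "('d::finite \<Rightarrow> nat) \<Rightarrow> complex ^ 'd \<Rightarrow> complex" where
  "monomial a z = (\<Prod>k\<in>UNIV. (z $ k) ^ a k)"

definition mscale :: "complex \<Rightarrow> complex ^ 'b ^ 'a \<Rightarrow> complex ^ 'b::finite ^ 'a::finite" where
  "mscale c M = map_matrix (\<lambda>x. c * x) M"

abbreviation complex_matrix :: "real ^ 'b ^ 'a \<Rightarrow> complex ^ 'b::finite ^ 'a::finite" where
  "complex_matrix M \<equiv> map_matrix complex_of_real M"

text \<open>Forms are represented by the functions they induce on complex d-space. The
  coefficients are determined by that function; the zero form has every degree.\<close>

definition real_form :: "nat \<Rightarrow> (complex ^ 'd::finite \<Rightarrow> complex) \<Rightarrow> bool" where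
  "real_form n q \<longleftrightarrow>
     (\<exists>c :: ('d \<Rightarrow> nat) \<Rightarrow> real. \<forall>z. q z = (\<Sum>a\<in>exponents n. complex_of_real (c a) * monomial a z))"

definition real_matrix_form ::
    "nat \<Rightarrow> (complex ^ 'd::finite \<Rightarrow> complex ^ 'b::finite ^ 'a::finite) \<Rightarrow> bool" where
  "real_matrix_form n P \<longleftrightarrow>
     (\<exists>B :: ('d \<Rightarrow> nat) \<Rightarrow> real ^ 'b ^ 'a.
        \<forall>z. P z = (\<Sum>a\<in>exponents n. mscale (monomial a z) (complex_matrix (B a))))"

definition partial_deriv ::
    "'d::finite \<Rightarrow> (complex ^ 'd \<Rightarrow> complex) \<Rightarrow> complex ^ 'd \<Rightarrow> complex" where
  "partial_deriv k f z = deriv (\<lambda>t. f (\<chi> i. if i = k then t else z $ i)) (z $ k)"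

definition matrix_partial_deriv ::
    "'d::finite \<Rightarrow> (complex ^ 'd \<Rightarrow> complex ^ 'b ^ 'a) \<Rightarrow> complex ^ 'd
       \<Rightarrow> complex ^ 'b::finite ^ 'a::finite" where
  "matrix_partial_deriv k P z = (\<chi> i j. partial_deriv k (\<lambda>w. P w $ i $ j) z)"

definition partial_wronskian ::
    "'d::finite \<Rightarrow> (complex ^ 'd \<Rightarrow> complex) \<Rightarrow> (complex ^ 'd \<Rightarrow> complex ^ 'b ^ 'a)
       \<Rightarrow> complex ^ 'd \<Rightarrow> complex ^ 'b::finite ^ 'a::finite" where
  "partial_wronskian k q P z =
     mscale (q z) (matrix_partial_deriv k P z) - mscale (partial_deriv k q z) (P z)"

text \<open>The block row of the matrices monomial times identity. A column index is a pair:
  the number of the block, and the column inside that block.\<close>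

definition Psi ::
    "('N \<Rightarrow> 'd \<Rightarrow> nat) \<Rightarrow> complex ^ 'd::finite \<Rightarrow> complex ^ ('N::finite \<times> 'm::finite) ^ 'm" where
  "Psi \<alpha> z = (\<chi> i p. mscale (monomial (\<alpha> (fst p)) z) (mat 1) $ i $ snd p)"

end

theory Submission imports Defs begin

text \<open>
  Entry by entry, part (i) asks for real coefficients \<open>a k \<beta> \<delta>\<close>, symmetric in the two exponents
  \<open>\<beta>\<close>, \<open>\<delta>\<close> of degree \<open>n\<close>, with
  \<open>q \<sigma> * p z = (\<Sum>k \<beta> \<delta>. a k \<beta> \<delta> * \<sigma>^\<beta> * z\<^sub>k * z^\<delta>)\<close>.
  Only the symmetry is an obstacle. The functions with such coefficients form a real vector space,
  so it suffices to reach each product \<open>\<sigma>^\<beta> * z^\<gamma>\<close> with \<open>\<beta>\<close> of degree \<open>n\<close> and \<open>\<gamma>\<close> of degree \<open>n + 1\<close>.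
  Placing a symmetric pair of ones in \<open>a k\<close> shows that, modulo this space and with \<open>e\<^sub>k\<close> for
  the unit vectors,
  \<open>\<sigma>^\<beta> * z^(\<delta> + e\<^sub>k)\<close> is minus \<open>\<sigma>^\<delta> * z^(\<beta> + e\<^sub>k)\<close>: the two exponents change sides, except for one
  unit that stays with \<open>z\<close>, at the price of a sign (lemma \<open>symmetric_kernel_swap\<close>). Two swaps,
  with the units \<open>e\<^sub>k\<close> and \<open>e\<^sub>j\<close>, restore the sign and trade one unit of \<open>\<beta>\<close> for one unit of \<open>\<gamma>\<close>
  (\<open>symmetric_kernel_exchange\<close>). Such trades connect all pairs \<open>(\<beta>, \<gamma>)\<close> with a given sum
  (\<open>symmetric_kernel_same_product\<close>), so these products are all congruent to one
  another. A single swap also keeps the sum \<open>\<beta> + \<gamma>\<close>, but changes the sign, so each product is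
  congruent to its own negative, and hence to zero since one may divide by two
  (\<open>symmetric_kernel_monomials\<close>).

  The coefficients of the matrix identity must also be symmetric in the matrix indices \<open>i\<close>, \<open>j\<close>.
  This is achieved by choosing them as a function of the entry function \<open>\<lambda>z. P z $ i $ j\<close>
  alone, because \<open>P\<close> is symmetric.

  Part (ii) follows from (i) by differentiating with respect to \<open>z\<^sub>k\<close> and to \<open>\<sigma>\<^sub>k\<close>, putting \<open>\<sigma> = z\<close>
  and subtracting. The derivative of the factor \<open>z\<^sub>k\<close> gives the right-hand side, and the terms in
  which a monomial of degree \<open>n\<close> is differentiated cancel by the symmetry of \<open>a\<close>
  (\<open>scalar_wronskian\<close>).
\<close>

section \<open>Raising an exponent by a unit\<close>

definition inc :: "'d \<Rightarrow> ('d \<Rightarrow> nat) \<Rightarrow> 'd \<Rightarrow> nat" where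
  "inc k a = a(k := Suc (a k))"

lemma inc_commute: "inc j (inc k a) = inc k (inc j a)"
  by (auto simp: inc_def)

lemma sum_inc: "(\<Sum>i\<in>UNIV. inc k a i) = Suc (\<Sum>i\<in>UNIV. a i)" for k :: "'d::finite"
  by (simp add: inc_def sum.remove[of UNIV k])

lemma inc_in_exponents_iff [simp]: "inc k a \<in> exponents (Suc n) \<longleftrightarrow> a \<in> exponents n"
  by (simp add: exponents_def sum_inc)

lemma obtain_inc:
  assumes "0 < a k" obtains b where "a = inc k b"
proof
  show "a = inc k (a(k := a k - 1))" using assms by (auto simp: inc_def)
qed

lemma monomial_inc: "monomial (inc k a) z = z $ k * monomial a z"
proof -
  have "(\<Prod>i\<in>UNIV - {k}. (z $ i) ^ inc k a i) = (\<Prod>i\<in>UNIV - {k}. (z $ i) ^ a i)"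
    by (rule prod.cong) (auto simp: inc_def)
  then show ?thesis
    by (simp add: monomial_def prod.remove[of UNIV k] inc_def)
qed

section \<open>Kernels with symmetric coefficients\<close>

definition kernel_coeffs ::
    "nat \<Rightarrow> ('d::finite \<Rightarrow> ('d \<Rightarrow> nat) \<Rightarrow> ('d \<Rightarrow> nat) \<Rightarrow> real) \<Rightarrow>
     (complex ^ 'd \<Rightarrow> complex ^ 'd \<Rightarrow> complex) \<Rightarrow> bool" where
  "kernel_coeffs n a f \<longleftrightarrow>
     (\<forall>k \<beta> \<delta>. a k \<beta> \<delta> = a k \<delta> \<beta>) \<and>
     (\<forall>\<sigma> z. f \<sigma> z = (\<Sum>k\<in>UNIV. \<Sum>\<beta>\<in>exponents n. \<Sum>\<delta>\<in>exponents n.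
        of_real (a k \<beta> \<delta>) * (monomial \<beta> \<sigma> * (z $ k * monomial \<delta> z))))"

abbreviation symmetric_kernel where
  "symmetric_kernel n f \<equiv> \<exists>a. kernel_coeffs n a f"

lemma symmetric_kernel_add:
  assumes "symmetric_kernel n f" "symmetric_kernel n g"
  shows "symmetric_kernel n (\<lambda>\<sigma> z. f \<sigma> z + g \<sigma> z)"
proof -
  obtain a b where "kernel_coeffs n a f" "kernel_coeffs n b g" using assms by blast
  then have "kernel_coeffs n (\<lambda>k \<beta> \<delta>. a k \<beta> \<delta> + b k \<beta> \<delta>) (\<lambda>\<sigma> z. f \<sigma> z + g \<sigma> z)"
    by (simp add: kernel_coeffs_def sum.distrib distrib_right)
  then show ?thesis by blast
qed

lemma symmetric_kernel_scale:
  assumes "symmetric_kernel n f"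
  shows "symmetric_kernel n (\<lambda>\<sigma> z. of_real c * f \<sigma> z)"
proof -
  obtain a where "kernel_coeffs n a f" using assms by blast
  then have "kernel_coeffs n (\<lambda>k \<beta> \<delta>. c * a k \<beta> \<delta>) (\<lambda>\<sigma> z. of_real c * f \<sigma> z)"
    by (simp add: kernel_coeffs_def sum_distrib_left mult.assoc)
  then show ?thesis by blast
qed

lemma symmetric_kernel_diff:
  assumes "symmetric_kernel n f" "symmetric_kernel n g"
  shows "symmetric_kernel n (\<lambda>\<sigma> z. f \<sigma> z - g \<sigma> z)"
  using symmetric_kernel_add[OF assms(1) symmetric_kernel_scale[OF assms(2), of "-1"]] by simp

lemma symmetric_kernel_zero: "symmetric_kernel n (\<lambda>\<sigma> z. 0)"
  by (rule exI[of _ "\<lambda>k \<beta> \<delta>. 0"]) (simp add: kernel_coeffs_def)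

lemma symmetric_kernel_sum:
  assumes "\<And>i. i \<in> I \<Longrightarrow> symmetric_kernel n (f i)"
  shows "symmetric_kernel n (\<lambda>\<sigma> z. \<Sum>i\<in>I. f i \<sigma> z)"
  using assms
proof (induction I rule: infinite_finite_induct)
  case (insert i I)
  then show ?case by (simp add: symmetric_kernel_add)
qed (simp_all add: symmetric_kernel_zero)

text \<open>The generators of the space of symmetric kernels: the coefficient array of index \<open>k\<close> has
  ones in positions \<open>(\<beta>, \<delta>)\<close> and \<open>(\<delta>, \<beta>)\<close>, and all other coefficients vanish. For \<open>\<beta> = \<delta>\<close>
  the two ones add up.\<close>

lemma symmetric_kernel_swap:
  assumes "\<beta> \<in> exponents n" "\<delta> \<in> exponents n"
  shows "symmetric_kernel n
    (\<lambda>\<sigma> z. monomial \<beta> \<sigma> * monomial (inc k \<delta>) z + monomial \<delta> \<sigma> * monomial (inc k \<beta>) z)"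
proof -
  define e where "e \<beta> \<delta> = (\<lambda>k' \<beta>' \<delta>'. (if \<delta>' = \<delta> then if \<beta>' = \<beta> then if k' = k then 1 else 0 else 0 else 0) :: real)"
    for \<beta> \<delta> :: "'a \<Rightarrow> nat"
  have e: "(\<Sum>k'\<in>UNIV. \<Sum>\<beta>'\<in>exponents n. \<Sum>\<delta>'\<in>exponents n.
        of_real (e \<beta> \<delta> k' \<beta>' \<delta>') * (monomial \<beta>' \<sigma> * (z $ k' * monomial \<delta>' z)))
      = monomial \<beta> \<sigma> * monomial (inc k \<delta>) z"
    if "\<beta> \<in> exponents n" "\<delta> \<in> exponents n" for \<beta> \<delta> \<sigma> z
    using that
    by (simp add: e_def monomial_inc finite_exponents if_distrib[of complex_of_real]
        if_distrib[of "\<lambda>x. x * _"] sum.delta cong: if_cong)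
  have "kernel_coeffs n (\<lambda>k' \<beta>' \<delta>'. e \<beta> \<delta> k' \<beta>' \<delta>' + e \<delta> \<beta> k' \<beta>' \<delta>')
    (\<lambda>\<sigma> z. monomial \<beta> \<sigma> * monomial (inc k \<delta>) z + monomial \<delta> \<sigma> * monomial (inc k \<beta>) z)"
    unfolding kernel_coeffs_def
  proof (intro conjI allI)
    show "e \<beta> \<delta> k' \<beta>' \<delta>' + e \<delta> \<beta> k' \<beta>' \<delta>' = e \<beta> \<delta> k' \<delta>' \<beta>' + e \<delta> \<beta> k' \<delta>' \<beta>'" for k' \<beta>' \<delta>'
      by (auto simp: e_def)
  qed (use e assms in \<open>simp add: distrib_right sum.distrib\<close>)
  then show ?thesis by blast
qed

text \<open>Modulo symmetric kernels, \<open>\<sigma>^(\<nu> + e\<^sub>j) * z^(\<mu> + e\<^sub>k)\<close> is minus \<open>\<sigma>^\<mu> * z^(\<nu> + e\<^sub>j + e\<^sub>k)\<close>. That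
  expression is symmetric in \<open>j\<close> and \<open>k\<close>, so these units may be traded.\<close>

lemma symmetric_kernel_exchange:
  assumes "inc j \<nu> \<in> exponents n" "\<mu> \<in> exponents n"
  shows "symmetric_kernel n (\<lambda>\<sigma> z. monomial (inc j \<nu>) \<sigma> * monomial (inc k \<mu>) z
     - monomial (inc k \<nu>) \<sigma> * monomial (inc j \<mu>) z)"
proof -
  have "inc k \<nu> \<in> exponents n"
    using assms(1) by (simp add: exponents_def sum_inc)
  then show ?thesis
    using symmetric_kernel_diff[OF symmetric_kernel_swap[OF assms, of k]
        symmetric_kernel_swap[OF \<open>inc k \<nu> \<in> exponents n\<close> assms(2), of j]]
    by (simp add: inc_commute[of j k])
qed

lemma obtain_larger_entry:
  fixes f g :: "'d::finite \<Rightarrow> nat"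
  assumes "sum f UNIV = sum g UNIV" "f \<noteq> g"
  obtains k where "g k < f k"
proof (rule ccontr)
  assume "\<not> thesis"
  then have "\<forall>k\<in>UNIV. f k \<le> g k" using that by (meson linorder_not_less)
  moreover obtain k where "f k \<noteq> g k" using assms(2) by blast
  ultimately have "sum f UNIV < sum g UNIV"
    by (intro sum_strict_mono_ex1) (auto intro!: bexI[of _ k] simp: order.strict_iff_order)
  then show False using assms(1) by simp
qed

text \<open>Unless \<open>\<gamma> = \<gamma>'\<close>, equality of degrees gives an index \<open>k\<close> where \<open>\<gamma>\<close> is too large and an
  index \<open>j\<close> where it is too small. At \<open>j\<close> the missing unit is present in \<open>\<beta>\<close>, as the sums of
  the two pairs agree. Exchanging the units brings \<open>\<gamma>\<close> closer to \<open>\<gamma>'\<close>.\<close>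

lemma symmetric_kernel_same_product:
  assumes "\<beta> \<in> exponents n" "\<gamma> \<in> exponents (Suc n)"
    and "\<beta>' \<in> exponents n" "\<gamma>' \<in> exponents (Suc n)"
    and "\<And>i. \<beta> i + \<gamma> i = \<beta>' i + \<gamma>' i"
  shows "symmetric_kernel n
    (\<lambda>\<sigma> z. monomial \<beta> \<sigma> * monomial \<gamma> z - monomial \<beta>' \<sigma> * monomial \<gamma>' z)"
  using assms
  \<comment> \<open>truncated subtraction: the measure counts the excess of \<open>\<gamma>\<close> over \<open>\<gamma>'\<close>\<close>
proof (induction "\<Sum>i\<in>UNIV. \<gamma> i - \<gamma>' i" arbitrary: \<beta> \<gamma> rule: less_induct)
  case less
  show ?case
  proof (cases "\<gamma> = \<gamma>'")
    case True
    then have "\<beta> = \<beta>'" using less.prems(5) by auto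
    with True show ?thesis by (simp add: symmetric_kernel_zero)
  next
    case False
    have eq: "sum \<gamma> UNIV = sum \<gamma>' UNIV"
      using less.prems(2,4) by (simp add: exponents_def)
    obtain k where k: "\<gamma>' k < \<gamma> k"
      using obtain_larger_entry[OF eq False] .
    obtain j where j: "\<gamma> j < \<gamma>' j"
      using obtain_larger_entry[OF eq[symmetric] False[symmetric]] .
    have "0 < \<beta> j" using less.prems(5)[of j] j by simp
    then obtain \<nu> where \<nu>: "\<beta> = inc j \<nu>" by (rule obtain_inc)
    obtain \<mu> where \<mu>: "\<gamma> = inc k \<mu>" using k by (metis obtain_inc gr0I not_less0)
    have \<mu>_in: "\<mu> \<in> exponents n" using less.prems(2) \<mu> by simp
    have \<nu>_in: "inc k \<nu> \<in> exponents n"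
      using less.prems(1) \<nu> by (simp add: exponents_def sum_inc)
    have neq: "j \<noteq> k" using k j by auto
    have "symmetric_kernel n
      (\<lambda>\<sigma> z. monomial (inc k \<nu>) \<sigma> * monomial (inc j \<mu>) z - monomial \<beta>' \<sigma> * monomial \<gamma>' z)"
    proof (rule less.hyps)
      show "(\<Sum>i\<in>UNIV. inc j \<mu> i - \<gamma>' i) < (\<Sum>i\<in>UNIV. \<gamma> i - \<gamma>' i)"
        using k j neq by (intro sum_strict_mono_ex1) (auto simp: \<mu> inc_def intro!: bexI[of _ k])
      show "inc k \<nu> i + inc j \<mu> i = \<beta>' i + \<gamma>' i" for i
        using less.prems(5)[of i] neq by (auto simp: \<mu> \<nu> inc_def split: if_splits)
    qed (use \<mu>_in \<nu>_in less.prems in simp_all)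
    from symmetric_kernel_add[OF symmetric_kernel_exchange[of j \<nu> n \<mu> k] this]
    show ?thesis using less.prems(1) \<mu>_in by (simp add: \<mu> \<nu>)
  qed
qed

text \<open>With \<open>\<gamma> = \<mu> + e\<^sub>k\<close>, the product \<open>\<sigma>^\<mu> * z^(\<beta> + e\<^sub>k)\<close> is congruent to \<open>\<sigma>^\<beta> * z^\<gamma>\<close>
  since the exponents have the same sum, and to its negative by a swap.\<close>

lemma symmetric_kernel_monomials:
  assumes "\<beta> \<in> exponents n" "\<gamma> \<in> exponents (Suc n)"
  shows "symmetric_kernel n (\<lambda>\<sigma> z. monomial \<beta> \<sigma> * monomial \<gamma> z)"
proof -
  have "\<exists>k. 0 < \<gamma> k"
  proof (rule ccontr)
    assume "\<not> ?thesis"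
    then have "sum \<gamma> UNIV = 0" by simp
    then show False using assms(2) by (simp add: exponents_def)
  qed
  then obtain k \<mu> where \<mu>: "\<gamma> = inc k \<mu>" by (metis obtain_inc)
  have \<mu>_in: "\<mu> \<in> exponents n" using assms \<mu> by simp
  have "symmetric_kernel n
      (\<lambda>\<sigma> z. monomial \<beta> \<sigma> * monomial \<gamma> z - monomial \<mu> \<sigma> * monomial (inc k \<beta>) z)"
  proof (rule symmetric_kernel_same_product)
    show "\<beta> i + \<gamma> i = \<mu> i + inc k \<beta> i" for i by (simp add: \<mu> inc_def)
  qed (use assms \<mu>_in in simp_all)
  from symmetric_kernel_scale[OF symmetric_kernel_add[OF this
      symmetric_kernel_swap[OF assms(1) \<mu>_in, of k]], of "1/2"]
  show ?thesis by (simp add: \<mu>)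
qed

lemma symmetric_kernel_forms:
  assumes "real_form n q" "real_form (Suc n) p"
  shows "symmetric_kernel n (\<lambda>\<sigma> z. q \<sigma> * p z)"
proof -
  obtain c where c: "\<And>z. q z = (\<Sum>\<beta>\<in>exponents n. of_real (c \<beta>) * monomial \<beta> z)"
    using assms(1) by (auto simp: real_form_def)
  obtain b where b: "\<And>z. p z = (\<Sum>\<gamma>\<in>exponents (Suc n). of_real (b \<gamma>) * monomial \<gamma> z)"
    using assms(2) by (auto simp: real_form_def)
  have "(\<lambda>\<sigma> z. q \<sigma> * p z) = (\<lambda>\<sigma> z. \<Sum>\<beta>\<in>exponents n. \<Sum>\<gamma>\<in>exponents (Suc n).
      of_real (c \<beta> * b \<gamma>) * (monomial \<beta> \<sigma> * monomial \<gamma> z))"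
    by (simp add: b c sum_product mult_ac)
  then show ?thesis
    by (simp only:) (intro symmetric_kernel_sum symmetric_kernel_scale symmetric_kernel_monomials)
qed

section \<open>The Wronskian of a scalar pair\<close>

text \<open>A relational form of \<open>partial_deriv\<close> that records the existence of the derivative, so that
  the rules of differentiation can be composed.\<close>

definition has_partial_deriv ::
    "'d::finite \<Rightarrow> (complex ^ 'd \<Rightarrow> complex) \<Rightarrow> complex \<Rightarrow> complex ^ 'd \<Rightarrow> bool" where
  "has_partial_deriv k f f' z \<longleftrightarrow>
     ((\<lambda>t. f (\<chi> i. if i = k then t else z $ i)) has_field_derivative f') (at (z $ k))"

lemma coordinate_line_base: "(\<chi> i. if i = k then z $ k else z $ i) = z"
  by (simp add: vec_eq_iff)

lemma has_partial_deriv_imp: "has_partial_deriv k f f' z \<Longrightarrow> partial_deriv k f z = f'"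
  by (simp add: has_partial_deriv_def partial_deriv_def DERIV_imp_deriv)

lemma has_partial_deriv_unique:
  "has_partial_deriv k f f' z \<Longrightarrow> has_partial_deriv k f f'' z \<Longrightarrow> f' = f''"
  by (auto simp: has_partial_deriv_def dest: DERIV_unique)

lemma has_partial_deriv_const: "has_partial_deriv k (\<lambda>z. c) 0 z"
  by (simp add: has_partial_deriv_def)

lemma has_partial_deriv_coord: "has_partial_deriv k (\<lambda>z. z $ l) (if l = k then 1 else 0) z"
  by (simp add: has_partial_deriv_def)

lemma has_partial_deriv_mult:
  "has_partial_deriv k f f' z \<Longrightarrow> has_partial_deriv k g g' z \<Longrightarrow>
   has_partial_deriv k (\<lambda>z. f z * g z) (f z * g' + f' * g z) z"
  unfolding has_partial_deriv_def
  by (drule (1) DERIV_mult) (simp add: coordinate_line_base mult_ac add_ac)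

lemma has_partial_deriv_sum:
  "(\<And>i. i \<in> I \<Longrightarrow> has_partial_deriv k (f i) (f' i) z) \<Longrightarrow>
   has_partial_deriv k (\<lambda>z. \<Sum>i\<in>I. f i z) (\<Sum>i\<in>I. f' i) z"
  unfolding has_partial_deriv_def by (rule DERIV_sum)

lemma has_partial_deriv_cmult:
  "has_partial_deriv k f f' z \<Longrightarrow> has_partial_deriv k (\<lambda>z. c * f z) (c * f') z"
  using has_partial_deriv_mult[OF has_partial_deriv_const] by simp

lemma has_partial_deriv_cmult_right:
  "has_partial_deriv k f f' z \<Longrightarrow> has_partial_deriv k (\<lambda>z. f z * c) (f' * c) z"
  using has_partial_deriv_cmult[of k f f' z c] by (simp add: mult.commute)

lemma has_partial_deriv_monomial:
  "has_partial_deriv k (monomial a) (partial_deriv k (monomial a) z) z"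
proof -
  let ?c = "\<Prod>i\<in>UNIV - {k}. (z $ i) ^ a i"
  have "monomial a (\<chi> i. if i = k then t else z $ i) = t ^ a k * ?c" for t
    by (auto simp: monomial_def prod.remove[of UNIV k] intro!: prod.cong)
  moreover have "((\<lambda>t. t ^ a k * ?c) has_field_derivative
      of_nat (a k) * z $ k ^ (a k - 1) * ?c) (at (z $ k))"
    by (auto intro!: derivative_eq_intros)
  ultimately have "has_partial_deriv k (monomial a) (of_nat (a k) * z $ k ^ (a k - 1) * ?c) z"
    by (simp add: has_partial_deriv_def)
  then show ?thesis by (metis has_partial_deriv_imp)
qed

lemma has_partial_deriv_real_form:
  assumes "real_form n q"
  shows "has_partial_deriv k q (partial_deriv k q z) z"
proof -
  obtain c where "q = (\<lambda>z. \<Sum>\<beta>\<in>exponents n. of_real (c \<beta>) * monomial \<beta> z)"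
    using assms by (auto simp: real_form_def)
  then have "has_partial_deriv k q
      (\<Sum>\<beta>\<in>exponents n. of_real (c \<beta>) * partial_deriv k (monomial \<beta>) z) z"
    by (simp only:)
      (intro has_partial_deriv_sum has_partial_deriv_cmult has_partial_deriv_monomial)
  then show ?thesis by (metis has_partial_deriv_imp)
qed

text \<open>Differentiating \<open>q z * p w\<close> in \<open>w\<close> and \<open>q w * p z\<close> in \<open>w\<close>, both at \<open>w = z\<close>, gives two
  expansions of the same shape, in which the derivative falls on \<open>z^\<delta>\<close> and on \<open>z^\<beta>\<close>
  respectively. As \<open>a l \<beta> \<delta>\<close> is symmetric in \<open>\<beta>\<close> and \<open>\<delta>\<close>, those parts are equal, and what
  remains of the first expansion comes from the derivative of the linear factor \<open>w $ l\<close>,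
  which is nonzero for \<open>l = k\<close> only.\<close>

lemma scalar_wronskian:
  assumes "real_form n q" "real_form (Suc n) p"
    and a: "kernel_coeffs n a (\<lambda>\<sigma> z. q \<sigma> * p z)"
  shows "q z * partial_deriv k p z - partial_deriv k q z * p z =
    (\<Sum>\<beta>\<in>exponents n. \<Sum>\<delta>\<in>exponents n. of_real (a k \<beta> \<delta>) * (monomial \<beta> z * monomial \<delta> z))"
proof -
  let ?E = "exponents n :: ('a \<Rightarrow> nat) set"
  let ?D = "\<lambda>\<beta>. partial_deriv k (monomial \<beta>) z"
  have sym: "a l \<beta> \<delta> = a l \<delta> \<beta>" for l \<beta> \<delta>
    using a by (simp add: kernel_coeffs_def)
  have rep: "q \<sigma> * p w = (\<Sum>l\<in>UNIV. \<Sum>\<beta>\<in>?E. \<Sum>\<delta>\<in>?E.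
      of_real (a l \<beta> \<delta>) * (monomial \<beta> \<sigma> * (w $ l * monomial \<delta> w)))" for \<sigma> w
    using a by (simp add: kernel_coeffs_def)
  have "has_partial_deriv k (\<lambda>w. q z * p w) (\<Sum>l\<in>UNIV. \<Sum>\<beta>\<in>?E. \<Sum>\<delta>\<in>?E.
      of_real (a l \<beta> \<delta>) * (monomial \<beta> z *
        (z $ l * ?D \<delta> + (if l = k then 1 else 0) * monomial \<delta> z))) z"
    unfolding rep
    by (intro has_partial_deriv_sum has_partial_deriv_cmult has_partial_deriv_mult
        has_partial_deriv_coord has_partial_deriv_monomial)
  then have "q z * partial_deriv k p z = (\<Sum>l\<in>UNIV. \<Sum>\<beta>\<in>?E. \<Sum>\<delta>\<in>?E.
      of_real (a l \<beta> \<delta>) * (monomial \<beta> z *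
        (z $ l * ?D \<delta> + (if l = k then 1 else 0) * monomial \<delta> z)))"
    using has_partial_deriv_cmult[OF has_partial_deriv_real_form[OF assms(2)]]
    by (rule has_partial_deriv_unique[symmetric])
  also have "\<dots> = (\<Sum>l\<in>UNIV. \<Sum>\<beta>\<in>?E. \<Sum>\<delta>\<in>?E.
        of_real (a l \<beta> \<delta>) * (monomial \<beta> z * (z $ l * ?D \<delta>)))
      + (\<Sum>l\<in>UNIV. if l = k then \<Sum>\<beta>\<in>?E. \<Sum>\<delta>\<in>?E.
        of_real (a l \<beta> \<delta>) * (monomial \<beta> z * monomial \<delta> z) else 0)"
    unfolding sum.distrib[symmetric] by (rule sum.cong) (auto simp: sum.distrib distrib_left)
  finally have qp: "q z * partial_deriv k p z = (\<Sum>l\<in>UNIV. \<Sum>\<beta>\<in>?E. \<Sum>\<delta>\<in>?E.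
        of_real (a l \<beta> \<delta>) * (monomial \<beta> z * (z $ l * ?D \<delta>)))
      + (\<Sum>\<beta>\<in>?E. \<Sum>\<delta>\<in>?E. of_real (a k \<beta> \<delta>) * (monomial \<beta> z * monomial \<delta> z))"
    by simp
  have "has_partial_deriv k (\<lambda>w. q w * p z) (\<Sum>l\<in>UNIV. \<Sum>\<beta>\<in>?E. \<Sum>\<delta>\<in>?E.
      of_real (a l \<beta> \<delta>) * (?D \<beta> * (z $ l * monomial \<delta> z))) z"
    unfolding rep
    by (intro has_partial_deriv_sum has_partial_deriv_cmult has_partial_deriv_cmult_right
        has_partial_deriv_monomial)
  then have "partial_deriv k q z * p z = (\<Sum>l\<in>UNIV. \<Sum>\<beta>\<in>?E. \<Sum>\<delta>\<in>?E.
      of_real (a l \<beta> \<delta>) * (?D \<beta> * (z $ l * monomial \<delta> z)))"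
    using has_partial_deriv_cmult_right[OF has_partial_deriv_real_form[OF assms(1)]]
    by (rule has_partial_deriv_unique[symmetric])
  also have "\<dots> = (\<Sum>l\<in>UNIV. \<Sum>\<delta>\<in>?E. \<Sum>\<beta>\<in>?E.
      of_real (a l \<delta> \<beta>) * (?D \<beta> * (z $ l * monomial \<delta> z)))"
    by (rule sum.cong[OF refl], subst sum.swap, intro sum.cong refl) (simp add: sym)
  finally show ?thesis
    using qp by (simp add: mult_ac)
qed

section \<open>The matrix identity\<close>

lemma Psi_sandwich:
  "(Psi \<alpha> \<sigma> ** M ** transpose (Psi \<alpha> z)) $ i $ j =
     (\<Sum>a\<in>UNIV. \<Sum>b\<in>UNIV. M $ (a, i) $ (b, j) * (monomial (\<alpha> a) \<sigma> * monomial (\<alpha> b) z))"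
proof -
  have left: "(\<Sum>p\<in>UNIV. Psi \<alpha> w $ i $ p * f p) = (\<Sum>a\<in>UNIV. monomial (\<alpha> a) w * f (a, i))"
    for w i f
    unfolding UNIV_Times_UNIV[symmetric] sum.cartesian_product'
    by (simp add: Psi_def mscale_def map_matrix_def mat_def if_distrib[of "\<lambda>x. x * _"]
        if_distrib[of "\<lambda>x. _ * x"] sum.delta sum.delta' cong: if_cong)
  have "(Psi \<alpha> \<sigma> ** M ** transpose (Psi \<alpha> z)) $ i $ j =
      (\<Sum>r\<in>UNIV. Psi \<alpha> z $ j $ r * (\<Sum>p\<in>UNIV. Psi \<alpha> \<sigma> $ i $ p * M $ p $ r))"
    by (simp add: matrix_matrix_mult_def transpose_def mult.commute)
  also have "\<dots> = (\<Sum>b\<in>UNIV. \<Sum>a\<in>UNIV. M $ (a, i) $ (b, j) * (monomial (\<alpha> a) \<sigma> * monomial (\<alpha> b) z))"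
    unfolding left by (simp add: sum_distrib_left mult_ac)
  also have "\<dots> = (\<Sum>a\<in>UNIV. \<Sum>b\<in>UNIV. M $ (a, i) $ (b, j) * (monomial (\<alpha> a) \<sigma> * monomial (\<alpha> b) z))"
    by (rule sum.swap)
  finally show ?thesis .
qed

lemma real_form_entry:
  assumes "real_matrix_form n P"
  shows "real_form n (\<lambda>z. P z $ i $ j)"
proof -
  obtain B where "\<And>z. P z = (\<Sum>a\<in>exponents n. mscale (monomial a z) (complex_matrix (B a)))"
    using assms by (auto simp: real_matrix_form_def)
  then show ?thesis
    by (auto simp: real_form_def mscale_def map_matrix_def mult.commute
        intro!: exI[of _ "\<lambda>a. B a $ i $ j"])
qed

theorem theorem5p1:
  fixes n :: nat
    and q :: "complex ^ 'd::finite \<Rightarrow> complex"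
    and P :: "complex ^ 'd \<Rightarrow> complex ^ 'm::finite ^ 'm"
    and \<alpha> :: "'N::finite \<Rightarrow> 'd \<Rightarrow> nat"
  assumes "real_form n q"
    and "real_matrix_form (n + 1) P"
    and "\<forall>z. transpose (P z) = P z"
    and "bij_betw \<alpha> UNIV (exponents n)"
  shows "\<exists>A :: 'd \<Rightarrow> real ^ ('N \<times> 'm) ^ ('N \<times> 'm).
    (\<forall>k. transpose (A k) = A k) \<and>
    (\<forall>\<sigma> z. mscale (q \<sigma>) (P z) =
       Psi \<alpha> \<sigma> ** (\<Sum>k\<in>UNIV. mscale (z $ k) (complex_matrix (A k))) ** transpose (Psi \<alpha> z)) \<and>
    (\<forall>k z. partial_wronskian k q P z =
       Psi \<alpha> z ** complex_matrix (A k) ** transpose (Psi \<alpha> z))"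
proof -
  have entry: "real_form (Suc n) (\<lambda>z. P z $ i $ j)" for i j
    using real_form_entry[OF assms(2)] by simp
  have P_sym: "P z $ i $ j = P z $ j $ i" for z i j
    using assms(3) by (metis transpose_def vec_lambda_beta)
  \<comment> \<open>The choice depends on \<open>i\<close> and \<open>j\<close> only through the function \<open>\<lambda>z. P z $ i $ j\<close>, so it is
    symmetric in \<open>i\<close> and \<open>j\<close>.\<close>
  define T where "T i j = (SOME a. kernel_coeffs n a (\<lambda>\<sigma> z. q \<sigma> * P z $ i $ j))" for i j
  have T: "kernel_coeffs n (T i j) (\<lambda>\<sigma> z. q \<sigma> * P z $ i $ j)" for i j
    unfolding T_def by (rule someI_ex[OF symmetric_kernel_forms[OF assms(1) entry]])
  have T_sym: "T i j = T j i" for i j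
    unfolding T_def by (subst P_sym) (rule refl)
  have T_swap: "T i j k \<beta> \<delta> = T i j k \<delta> \<beta>" for i j k \<beta> \<delta>
    using T[of i j] unfolding kernel_coeffs_def by blast
  define A :: "'d \<Rightarrow> real ^ ('N \<times> 'm) ^ ('N \<times> 'm)" where
    "A k = (\<chi> r s. T (snd r) (snd s) k (\<alpha> (fst r)) (\<alpha> (fst s)))" for k
  have A_nth: "A k $ (a, i) $ (b, j) = T i j k (\<alpha> a) (\<alpha> b)" for k a i b j
    by (simp add: A_def)
  have reindex: "(\<Sum>\<beta>\<in>exponents n. f \<beta>) = (\<Sum>a\<in>UNIV. f (\<alpha> a))" for f :: "_ \<Rightarrow> complex"
    using sum.reindex_bij_betw[OF assms(4), of f] by simp
  have "transpose (A k) = A k" for k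
    by (simp add: A_def transpose_def vec_eq_iff T_swap T_sym)
  moreover have "mscale (q \<sigma>) (P z) = Psi \<alpha> \<sigma> **
      (\<Sum>k\<in>UNIV. mscale (z $ k) (complex_matrix (A k))) ** transpose (Psi \<alpha> z)" for \<sigma> z
  proof -
    have "mscale (q \<sigma>) (P z) $ i $ j = (Psi \<alpha> \<sigma> **
      (\<Sum>k\<in>UNIV. mscale (z $ k) (complex_matrix (A k))) ** transpose (Psi \<alpha> z)) $ i $ j" for i j
    proof -
      have "mscale (q \<sigma>) (P z) $ i $ j = (\<Sum>k\<in>UNIV. \<Sum>a\<in>UNIV. \<Sum>b\<in>UNIV.
          of_real (T i j k (\<alpha> a) (\<alpha> b)) * (monomial (\<alpha> a) \<sigma> * (z $ k * monomial (\<alpha> b) z)))"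
        using T[of i j] by (simp add: kernel_coeffs_def reindex mscale_def map_matrix_def)
      also have "\<dots> = (\<Sum>a\<in>UNIV. \<Sum>b\<in>UNIV. \<Sum>k\<in>UNIV.
          of_real (T i j k (\<alpha> a) (\<alpha> b)) * (monomial (\<alpha> a) \<sigma> * (z $ k * monomial (\<alpha> b) z)))"
        by (subst sum.swap, intro sum.cong refl, rule sum.swap)
      also have "\<dots> = (Psi \<alpha> \<sigma> **
          (\<Sum>k\<in>UNIV. mscale (z $ k) (complex_matrix (A k))) ** transpose (Psi \<alpha> z)) $ i $ j"
        unfolding Psi_sandwich
        by (simp add: sum_distrib_left sum_distrib_right mscale_def map_matrix_def A_nth mult_ac)
      finally show ?thesis .
    qed
    then show ?thesis by (simp add: vec_eq_iff)
  qed
  moreover have "partial_wronskian k q P z =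
      Psi \<alpha> z ** complex_matrix (A k) ** transpose (Psi \<alpha> z)" for k z
  proof -
    have "partial_wronskian k q P z $ i $ j =
        (Psi \<alpha> z ** complex_matrix (A k) ** transpose (Psi \<alpha> z)) $ i $ j" for i j
      using scalar_wronskian[OF assms(1) entry T[of i j], where z = z and k = k]
      unfolding Psi_sandwich
      by (simp add: partial_wronskian_def matrix_partial_deriv_def mscale_def map_matrix_def
          A_nth reindex)
    then show ?thesis by (simp add: vec_eq_iff)
  qed
  ultimately show ?thesis by blast
qed

end
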